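(* Let $\mathscr{F}$ be a field, let $n \geq 1$ and $k \geq 1$ be integers, let $G \in M_n(\mathscr{F})$, and let $n_1, \ldots, n_k, n_{Z_1}, n_{Z_2} \in \mathbb{N}$. The following two statements are equivalent. 1. There exist matrices $E_1, \ldots, E_k, Z_1, Z_2 \in M_n(\mathscr{F})$ such that $G = E_1 \cdots E_k Z_1 Z_2$, where $E_i^2 = E_i$ and $\mathrm{n}(E_i) = n_i$ for each $i \in \{1, \ldots, k\}$, $Z_1^2 = Z_2^2 = \mathbf{0}$, $\mathrm{n}(Z_1) = n_{Z_1}$ and $\mathrm{n}(Z_2) = n_{Z_2}$. 2. All of the following hold: (i) $\mathrm{r}(G) \leq n_1 + \cdots + n_k + \mathrm{n}_0(G)$; (ii) each of $n_1, \ldots, n_k, n_{Z_1}, n_{Z_2}$ is at most $\mathrm{n}(G)$; (iii) $n_{Z_1} \geq n/2$ and $n_{Z_2} \geq n/2$.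
   Context: $M_n(\mathscr{F})$ is the set of $n \times n$ matrices over the field $\mathscr{F}$, and $\mathbb{N}$ denotes the non-negative integers. For $G \in M_n(\mathscr{F})$, $\mathrm{N}(G)$ is the null space and $\mathrm{R}(G)$ the range (column space) of $G$, as subspaces of $\mathscr{F}^n$; $\mathrm{n}(G) = \dim \mathrm{N}(G)$ is the nullity and $\mathrm{r}(G) = \dim \mathrm{R}(G)$ is the rank. Define $\mathrm{n}_0(G) = \mathrm{n}(G) - \dim(\mathrm{R}(G) \cap \mathrm{N}(G))$. *)

theory Defs
  imports "HOL-Analysis.Analysis"
begin

text \<open>
  A square matrix over a field \<open>'a\<close> has type \<open>'a^'n^'n\<close>; its size is \<open>CARD('n)\<close>, which is
  positive. Dimensions are taken with \<open>vec.dim\<close>, the dimension over an arbitrary field; the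
  unqualified \<open>dim\<close> of the library is the dimension over the reals.
\<close>

definition null_space :: "'a::field^'n^'n \<Rightarrow> ('a^'n) set" where
  "null_space G = {x. G *v x = 0}"

definition range_space :: "'a::field^'n^'n \<Rightarrow> ('a^'n) set" where
  "range_space G = range (\<lambda>x. G *v x)"

definition nullity :: "'a::field^'n^'n \<Rightarrow> nat" where
  "nullity G = vec.dim (null_space G)"

text \<open>The library constant \<open>rank\<close> is defined as the row rank, hence a separate column rank.\<close>

definition range_rank :: "'a::field^'n^'n \<Rightarrow> nat" where
  "range_rank G = vec.dim (range_space G)"

definition nullity0 :: "'a::field^'n^'n \<Rightarrow> nat" where
  "nullity0 G = nullity G - vec.dim (range_space G \<inter> null_space G)"

text \<open>The subtraction in \<open>nullity0\<close> is never truncated.\<close>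

lemma nullity0_add:
  "nullity0 G + vec.dim (range_space G \<inter> null_space G) = nullity G"
  using vec.dim_subset[of "range_space G \<inter> null_space G" "null_space G"]
  by (simp add: nullity0_def nullity_def)

text \<open>\<open>matrix_prod E k\<close> is the ordered product \<open>E 1 ** \<dots> ** E k\<close>.\<close>

primrec matrix_prod :: "(nat \<Rightarrow> 'a::field^'n^'n) \<Rightarrow> nat \<Rightarrow> 'a^'n^'n" where
  "matrix_prod E 0 = mat 1"
| "matrix_prod E (Suc k) = matrix_prod E k ** E (Suc k)"

end

theory Submission
  imports Defs
begin

text \<open>
  Write \<open>n = CARD('n)\<close>, let \<open>R\<close> and \<open>N\<close> be the range and the null space of \<open>G\<close>, and let \<open>s\<close> be the
  sum of the \<open>ns i\<close>. As \<open>nullity0 G = nullity G - dim (R \<inter> N)\<close>, the rank condition reads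
  \<open>rank G + dim (R \<inter> N) \<le> nullity G + s\<close>.

  Necessity. A product \<open>P\<close> of idempotents fixes every vector that all factors fix, so its fixed space
  has codimension at most \<open>s\<close>. Suppose that \<open>G = P Z1 Z2\<close>. Since \<open>Z2\<close> squares to zero, its range lies
  in \<open>N\<close>; hence \<open>P Z1\<close> maps \<open>N\<close> onto a space that contains \<open>R\<close>, and \<open>rank G\<close> is at most
  \<open>nullity G\<close> minus the dimension of the part of \<open>N\<close> killed by \<open>P Z1\<close>. That part is large: the range
  of \<open>Z1 Z2\<close> is killed by \<open>Z1\<close>, and what \<open>P\<close> fixes of it lies in \<open>R\<close> and has codimension at most
  \<open>s\<close> there, so it meets \<open>R \<inter> N\<close> in dimension at least \<open>dim (R \<inter> N) - s\<close>
  (\<open>rank_le_of_factorization\<close>).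

  Sufficiency. The obstruction \<open>dim (R \<inter> N)\<close> is removed first. An idempotent of nullity \<open>m\<close> can be split off,
  \<open>G = E H\<close>, so that \<open>H\<close> has the same null space as \<open>G\<close> and its range is tilted out of \<open>N\<close>: the
  dimension of range \<open>\<inter>\<close> null space drops by \<open>m\<close>, or to \<open>0\<close>
  (\<open>ex_idempotent_factor\<close>). After all \<open>k\<close> steps the remaining factor \<open>H\<close> satisfies
  \<open>rank H + dim (range H \<inter> N) \<le> nullity H\<close>; if the intersection has become trivial, this is
  \<open>rank H \<le> nullity H\<close>, which follows from the conditions on \<open>nZ1\<close>. Such an \<open>H\<close> is a product of two
  square-zero matrices: \<open>N\<close> has room for a copy \<open>W\<close> of the range of \<open>H\<close> that avoids the range, \<open>Z2\<close> sends
  a complement of \<open>N\<close> to \<open>W\<close>, and \<open>Z1\<close> carries \<open>W\<close> on to the range. The bounds on \<open>nZ1\<close>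
  and \<open>nZ2\<close> leave enough of the space unused to raise the ranks of \<open>Z1\<close> and \<open>Z2\<close> to the prescribed
  values without changing the product (\<open>ex_square_zero_factorization\<close>).
\<close>

section \<open>Range, null space and dimension counts\<close>

lemma subspace_null_space: "vec.subspace (null_space G)"
  unfolding null_space_def vec.subspace_def
  by (auto simp: matrix_vector_right_distrib vector_scalar_commute)

lemma range_space_eq_span: "vec.span B = UNIV \<Longrightarrow> range_space M = vec.span ((*v) M ` B)"
  unfolding range_space_def by (simp add: vec.span_image)

lemma subspace_range_space: "vec.subspace (range_space G)"
  unfolding range_space_eq_span[OF vec.span_UNIV] by (rule vec.subspace_span)

lemma in_range_space [simp]: "M *v x \<in> range_space M"
  by (simp add: range_space_def)

lemma in_null_space [simp]: "x \<in> null_space M \<longleftrightarrow> M *v x = 0"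
  by (simp add: null_space_def)

lemma eq_0_if_in_disjoint_spans:
  assumes B: "vec.independent B" and XY: "X \<subseteq> B" "Y \<subseteq> B" "X \<inter> Y = {}"
    and z: "z \<in> vec.span X" "z \<in> vec.span Y"
  shows "z = 0"
proof -
  have "vec.representation B z = vec.representation X z"
    by (rule vec.representation_extend[OF B z(1) XY(1)])
  moreover have "vec.representation B z = vec.representation Y z"
    by (rule vec.representation_extend[OF B z(2) XY(2)])
  ultimately have "vec.representation X z b = 0" for b
    using vec.representation_ne_zero[of X z b] vec.representation_ne_zero[of Y z b] XY(3) by auto
  then show ?thesis
    using vec.sum_nonzero_representation_eq[OF vec.independent_mono[OF B XY(1)] z(1)] by simp
qed

text \<open>
  Rank-nullity for the restriction of a matrix to a subspace. The restricted form is what both directions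
  need: it is applied to the null space of \<open>G\<close> and to the intersection of range and null space.
\<close>

lemma dim_image_add_dim_kernel:
  fixes M :: "'a::field^'n^'n"
  assumes S: "vec.subspace S"
  shows "vec.dim ((*v) M ` S) + vec.dim (S \<inter> null_space M) = vec.dim S"
proof -
  let ?K = "S \<inter> null_space M"
  obtain B0 where B0: "B0 \<subseteq> ?K" "vec.independent B0" "?K \<subseteq> vec.span B0" "card B0 = vec.dim ?K"
    using vec.basis_exists by blast
  obtain B where B: "B0 \<subseteq> B" "B \<subseteq> S" "vec.independent B" "S \<subseteq> vec.span B"
    using vec.maximal_independent_subset_extend[of B0 S] B0 by auto
  have fin: "finite B" using B(3) by (rule vec.finiteI_independent)
  let ?C = "B - B0"
  have CS: "vec.span ?C \<subseteq> S" using vec.span_minimal[OF _ S, of ?C] B(2) by auto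
  have inj: "inj_on ((*v) M) (vec.span ?C)"
  proof (rule inj_onI)
    fix x y assume xy: "x \<in> vec.span ?C" "y \<in> vec.span ?C" "M *v x = M *v y"
    let ?z = "x - y"
    have z: "?z \<in> vec.span ?C" using xy vec.span_diff by blast
    have "?z \<in> ?K" using z CS xy(3) by (auto simp: matrix_vector_mult_diff_distrib)
    then have z0: "?z \<in> vec.span B0" using B0(3) by auto
    have "?z = 0" by (rule eq_0_if_in_disjoint_spans[OF B(3,1) Diff_subset _ z0 z]) auto
    then show "x = y" by simp
  qed
  have "vec.span ((*v) M ` S) = vec.span ((*v) M ` ?C)"
  proof
    have "M *v b \<in> vec.span ((*v) M ` ?C)" if "b \<in> B" for b
    proof (cases "b \<in> B0")
      case True then show ?thesis using B0(1) by (auto simp: vec.span_zero)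
    next
      case False then show ?thesis using that by (auto intro: vec.span_base)
    qed
    then have "vec.span ((*v) M ` B) \<subseteq> vec.span ((*v) M ` ?C)"
      by (intro vec.span_minimal vec.subspace_span) auto
    moreover have "(*v) M ` S \<subseteq> vec.span ((*v) M ` B)"
      using B(4) by (auto simp: vec.span_image)
    ultimately show "vec.span ((*v) M ` S) \<subseteq> vec.span ((*v) M ` ?C)"
      by (intro vec.span_minimal vec.subspace_span) auto
    show "vec.span ((*v) M ` ?C) \<subseteq> vec.span ((*v) M ` S)"
      using B(2) by (intro vec.span_mono) auto
  qed
  then have "vec.dim ((*v) M ` S) = vec.dim ((*v) M ` ?C)" by (rule vec.span_eq_dim)
  also have "\<dots> = vec.dim ?C"
    by (rule vec.dim_image_eq[OF matrix_vector_mul_linear_gen inj])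
  also have "\<dots> = card ?C"
    using B(3) vec.independent_mono[of B ?C] by (intro vec.dim_eq_card_independent) auto
  also have "\<dots> = card B - card B0" using B(1) fin by (simp add: card_Diff_subset finite_subset)
  finally show ?thesis using B0(4) vec.basis_card_eq_dim[OF B(2,4,3)] card_mono[OF fin B(1)] by simp
qed

lemma rank_nullity: "range_rank G + nullity (G::'a::field^'n^'n) = CARD('n)"
  using dim_image_add_dim_kernel[OF vec.subspace_UNIV, of G]
  unfolding range_rank_def nullity_def range_space_def by (simp only: Int_UNIV_left vec_dim_card)

lemma dim_add_le_dim_Int:
  assumes "vec.subspace S" "vec.subspace T" "S \<subseteq> V" "T \<subseteq> V" "vec.subspace V"
  shows "vec.dim S + vec.dim T \<le> vec.dim (S \<inter> T) + vec.dim V"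
proof -
  have "{x + y |x y. x \<in> S \<and> y \<in> T} \<subseteq> V"
    using assms by (auto intro: vec.subspace_add)
  from vec.dim_subset[OF this] show ?thesis using vec.dim_sums_Int[OF assms(1,2)] by linarith
qed

lemma card_basis_UNIV:
  fixes B :: "('a::field^'n) set"
  assumes "vec.independent B" "vec.span B = UNIV"
  shows "finite B" "card B = CARD('n)"
  using vec.finiteI_independent[OF assms(1)] vec.dim_eq_card_independent[OF assms(1)] assms(2)
    vec_dim_card vec.dim_span[of B] by metis+

section \<open>Matrices prescribed on a basis\<close>

lemma matrix_eq_on_span:
  assumes "\<And>b. b \<in> B \<Longrightarrow> M *v b = N *v b" "x \<in> vec.span B"
  shows "M *v x = N *v x"
  using vec.linear_eq_on[OF matrix_vector_mul_linear_gen matrix_vector_mul_linear_gen assms(2,1)]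
  by auto

lemma matrix_eqI_basis:
  assumes "vec.span B = UNIV" "\<And>b. b \<in> B \<Longrightarrow> M *v b = N *v b"
  shows "M = N"
  using matrix_eq_on_span[of B M N] assms by (simp add: matrix_eq)

lemma ex_matrix_on_basis:
  fixes B :: "('a::field^'n) set" and f :: "'a^'n \<Rightarrow> 'a^'n"
  assumes "vec.independent B"
  shows "\<exists>M :: 'a^'n^'n. \<forall>b\<in>B. M *v b = f b"
proof -
  obtain g where "Vector_Spaces.linear (*s) (*s) g" "\<forall>x\<in>B. g x = f x"
    using vec.linear_independent_extend[OF assms] by blast
  then show ?thesis by (intro exI[of _ "matrix g"]) (simp add: matrix_works)
qed

text \<open>
  The idempotents and square-zero matrices below act as partial injections of a basis, sending each
  basis vector to a basis vector or to \<open>0\<close>. The rank then counts the vectors that survive, so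
  prescribing a nullity amounts to choosing a set of the right size.
\<close>

lemma nullity_of_partial_injection:
  fixes M :: "'a::field^'n^'n"
  assumes B: "vec.independent B" "vec.span B = UNIV" and "A \<subseteq> B"
    and f: "\<And>b. b \<in> A \<Longrightarrow> M *v b = f b" "inj_on f A" "f ` A \<subseteq> B"
    and zero: "\<And>b. b \<in> B - A \<Longrightarrow> M *v b = 0"
  shows "nullity M = CARD('n) - card A"
proof -
  have "vec.independent (f ` A)" using B(1) f(3) by (rule vec.independent_mono)
  then have "vec.dim (vec.span (f ` A)) = card A"
    using f(2) by (simp add: vec.dim_eq_card_independent card_image)
  moreover have "range_space M = vec.span (f ` A)"
    unfolding range_space_eq_span[OF B(2)]
  proof (intro antisym vec.span_minimal vec.subspace_span)
    show "(*v) M ` B \<subseteq> vec.span (f ` A)"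
    proof (rule image_subsetI)
      fix b assume "b \<in> B"
      then show "M *v b \<in> vec.span (f ` A)"
        using f(1) zero by (cases "b \<in> A") (auto simp: vec.span_zero intro: vec.span_base)
    qed
    show "f ` A \<subseteq> vec.span ((*v) M ` B)"
    proof (rule image_subsetI)
      fix b assume "b \<in> A"
      then have "f b \<in> (*v) M ` B" using f(1) \<open>A \<subseteq> B\<close> by force
      then show "f b \<in> vec.span ((*v) M ` B)" by (rule vec.span_base)
    qed
  qed
  ultimately show ?thesis using rank_nullity[of M] by (simp add: range_rank_def)
qed

text \<open>
  A partial injection whose image avoids its domain squares to zero.
\<close>

lemma ex_square_zero_on_basis:
  fixes B :: "('a::field^'n) set"
  assumes B: "vec.independent B" "vec.span B = UNIV" and A: "A \<subseteq> B"
    and f: "inj_on f A" "f ` A \<subseteq> B - A"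
  obtains Z :: "'a^'n^'n" where "\<And>b. b \<in> A \<Longrightarrow> Z *v b = f b" "\<And>b. b \<in> B - A \<Longrightarrow> Z *v b = 0"
    "Z ** Z = 0" "nullity Z = CARD('n) - card A"
proof -
  obtain Z :: "'a^'n^'n" where Z: "\<forall>b\<in>B. Z *v b = (if b \<in> A then f b else 0)"
    using ex_matrix_on_basis[OF B(1), where f = "\<lambda>b. if b \<in> A then f b else 0"] by blast
  have on: "Z *v b = f b" if "b \<in> A" for b using Z A that by auto
  have off: "Z *v b = 0" if "b \<in> B - A" for b using Z that by auto
  have "Z ** Z = 0"
  proof (rule matrix_eqI_basis[OF B(2)])
    fix b assume "b \<in> B"
    then show "(Z ** Z) *v b = 0 *v b"
      using on off f(2) by (cases "b \<in> A") (auto simp flip: matrix_vector_mul_assoc)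
  qed
  moreover have "nullity Z = CARD('n) - card A"
    using nullity_of_partial_injection[OF B A on f(1) _ off] f(2) by auto
  ultimately show ?thesis by (intro that[OF on off])
qed

lemma ex_idempotent_on_basis:
  fixes B :: "('a::field^'n) set"
  assumes B: "vec.independent B" "vec.span B = UNIV" and K: "K \<subseteq> B"
  obtains E :: "'a^'n^'n" where "\<And>b. b \<in> K \<Longrightarrow> E *v b = 0" "\<And>b. b \<in> B - K \<Longrightarrow> E *v b = b"
    "E ** E = E" "nullity E = card K"
proof -
  obtain E :: "'a^'n^'n" where E: "\<forall>b\<in>B. E *v b = (if b \<in> K then 0 else b)"
    using ex_matrix_on_basis[OF B(1), where f = "\<lambda>b. if b \<in> K then 0 else b"] by blast
  have "E ** E = E"
    by (rule matrix_eqI_basis[OF B(2)]) (simp add: E flip: matrix_vector_mul_assoc)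
  moreover have "nullity E = CARD('n) - card (B - K)"
    by (rule nullity_of_partial_injection[OF B, where f = id]) (use E K in auto)
  then have "nullity E = card K"
    using card_basis_UNIV[OF B] card_mono[OF _ K] K by (simp add: card_Diff_subset finite_subset)
  moreover have on: "E *v b = 0" if "b \<in> K" for b using E K that by auto
  moreover have off: "E *v b = b" if "b \<in> B - K" for b using E that by auto
  ultimately show ?thesis by (intro that[OF on off])
qed

text \<open>
  Extend a basis \<open>D\<close> of the intersection to bases of both subspaces. By the dimension formula, the union
  of the two spans a space of dimension at least the size of the union, which makes the union independent
  and leaves no room for common vectors outside \<open>D\<close>.
\<close>

lemma ex_basis_adapted:
  fixes R N :: "('a::field^'n) set"
  assumes "vec.subspace R" "vec.subspace N"
  obtains BR BN B where "vec.independent B" "vec.span B = UNIV" "BR \<subseteq> B" "BN \<subseteq> B"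
    "vec.span BR = R" "vec.span BN = N" "vec.span (BR \<inter> BN) = R \<inter> N"
proof -
  have RN: "vec.subspace (R \<inter> N)" using assms by (rule vec.subspace_inter)
  obtain D where D: "D \<subseteq> R \<inter> N" "vec.independent D" "R \<inter> N \<subseteq> vec.span D"
    by (rule vec.basis_exists)
  obtain BR where BR: "D \<subseteq> BR" "BR \<subseteq> R" "vec.independent BR" "R \<subseteq> vec.span BR"
    using vec.maximal_independent_subset_extend[of D R] D by auto
  obtain BN where BN: "D \<subseteq> BN" "BN \<subseteq> N" "vec.independent BN" "N \<subseteq> vec.span BN"
    using vec.maximal_independent_subset_extend[of D N] D by auto
  have sp: "vec.span D = R \<inter> N" "vec.span BR = R" "vec.span BN = N"
    using vec.span_subspace D BR BN RN assms by blast+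
  have fin: "finite BR" "finite BN" using BR(3) BN(3) by (auto intro: vec.finiteI_independent)
  have cards: "card D = vec.dim (R \<inter> N)" "card BR = vec.dim R" "card BN = vec.dim N"
    using vec.dim_span_eq_card_independent D(2) BR(3) BN(3) sp by metis+
  have dim: "vec.dim (vec.span (BR \<union> BN)) + card D = card BR + card BN"
    using vec.dim_sums_Int[OF assms] unfolding vec.span_Un sp cards .
  have Dle: "card D \<le> card (BR \<inter> BN)" using BR(1) BN(1) fin by (intro card_mono) auto
  have eq: "card (BR \<union> BN) + card (BR \<inter> BN) = card BR + card BN"
    using card_Un_Int[OF fin] by simp
  have ind: "vec.independent (BR \<union> BN)"
    by (rule vec.card_le_dim_spanning[of _ "vec.span (BR \<union> BN)"])
      (use fin dim Dle eq in \<open>auto simp: vec.span_superset simp del: vec.dim_span\<close>)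
  have "card (BR \<union> BN) = vec.dim (vec.span (BR \<union> BN))"
    using vec.dim_span_eq_card_independent[OF ind] by simp
  then have "D = BR \<inter> BN"
    using eq dim BR(1) BN(1) fin by (intro card_subset_eq) auto
  moreover obtain B where B: "BR \<union> BN \<subseteq> B" "B \<subseteq> UNIV" "vec.independent B" "UNIV \<subseteq> vec.span B"
    by (rule vec.maximal_independent_subset_extend[OF subset_UNIV ind])
  ultimately show ?thesis using sp by (intro that[of B BR BN]) auto
qed

lemma ex_basis_adapted_matrix:
  fixes G :: "'a::field^'n^'n"
  obtains BR BN B where "vec.independent B" "vec.span B = UNIV" "BR \<subseteq> B" "BN \<subseteq> B"
    "vec.span BR = range_space G" "vec.span BN = null_space G"
    "vec.span (BR \<inter> BN) = range_space G \<inter> null_space G"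
    "finite B" "card B = CARD('n)" "card BR = range_rank G" "card BN = nullity G"
    "card (BR \<inter> BN) = vec.dim (range_space G \<inter> null_space G)"
proof -
  obtain BR BN B where B: "vec.independent B" "vec.span B = UNIV" "BR \<subseteq> B" "BN \<subseteq> B"
    and sp: "vec.span BR = range_space G" "vec.span BN = null_space G"
      "vec.span (BR \<inter> BN) = range_space G \<inter> null_space G"
    by (rule ex_basis_adapted[OF subspace_range_space[of G] subspace_null_space[of G]])
  have "card A = vec.dim (vec.span A)" if "A \<subseteq> B" for A
    using vec.dim_span_eq_card_independent[OF vec.independent_mono[OF B(1) that]] by simp
  then have "card BR = range_rank G" "card BN = nullity G"
    "card (BR \<inter> BN) = vec.dim (range_space G \<inter> null_space G)"
    using B(3,4) sp unfolding range_rank_def nullity_def by (metis le_infI1)+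
  then show ?thesis by (rule that[OF B sp card_basis_UNIV[OF B(1,2)]])
qed

section \<open>Bounds forced by a factorization\<close>

lemma range_rank_mult_le:
  fixes A B :: "'a::field^'n^'n"
  shows "range_rank (A ** B) \<le> range_rank A" "range_rank (A ** B) \<le> range_rank B"
proof -
  have eq: "range_space (A ** B) = (*v) A ` range_space B"
    by (auto simp: range_space_def simp flip: matrix_vector_mul_assoc)
  show "range_rank (A ** B) \<le> range_rank A"
    unfolding range_rank_def eq by (rule vec.dim_subset) (auto simp: range_space_def)
  show "range_rank (A ** B) \<le> range_rank B"
    unfolding range_rank_def eq by (rule vec.dim_image_le[OF matrix_vector_mul_linear_gen])
qed

lemma nullity_le_mult:
  fixes A B :: "'a::field^'n^'n"
  shows "nullity A \<le> nullity (A ** B)" "nullity B \<le> nullity (A ** B)"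
  using range_rank_mult_le[of A B] rank_nullity[of A] rank_nullity[of B] rank_nullity[of "A ** B"]
  by linarith+

lemma nullity_matrix_prod_ge:
  "i \<in> {1..k} \<Longrightarrow> nullity (E i) \<le> nullity (matrix_prod E k)"
proof (induction k)
  case (Suc k)
  then show ?case
    using nullity_le_mult[where A = "matrix_prod E k" and B = "E (Suc k)"]
    by (cases "i = Suc k") (auto intro: order_trans)
qed simp

lemma nullity_square_zero_ge:
  fixes Z :: "'a::field^'n^'n"
  assumes "Z ** Z = 0"
  shows "CARD('n) \<le> 2 * nullity Z"
proof -
  have "Z *v (Z *v x) = 0" for x using assms by (simp add: matrix_vector_mul_assoc)
  then have "range_space Z \<subseteq> null_space Z" by (auto simp: range_space_def)
  then have "range_rank Z \<le> nullity Z" unfolding range_rank_def nullity_def by (rule vec.dim_subset)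
  then show ?thesis using rank_nullity[of Z] by simp
qed

definition fixed_space :: "'a::field^'n^'n \<Rightarrow> ('a^'n) set" where
  "fixed_space P = {x. P *v x = x}"

lemma subspace_fixed_space: "vec.subspace (fixed_space P)"
  unfolding fixed_space_def vec.subspace_def
  by (auto simp: matrix_vector_right_distrib vector_scalar_commute)

text \<open>
  An idempotent fixes its range, so each factor lowers the dimension of the common fixed space by at
  most its nullity.
\<close>

lemma dim_fixed_space_matrix_prod:
  fixes E :: "nat \<Rightarrow> 'a::field^'n^'n"
  assumes "\<forall>i\<in>{1..k}. E i ** E i = E i"
  shows "CARD('n) \<le> vec.dim (fixed_space (matrix_prod E k)) + (\<Sum>i=1..k. nullity (E i))"
  using assms
proof (induction k)
  case 0
  show ?case by (simp add: fixed_space_def vec_dim_card del: vec.dim_UNIV)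
next
  case (Suc k)
  let ?P = "matrix_prod E k" and ?E = "E (Suc k)"
  have "?E ** ?E = ?E" using Suc.prems by simp
  then have "?E *v (?E *v x) = ?E *v x" for x by (simp add: matrix_vector_mul_assoc)
  then have "fixed_space ?P \<inter> range_space ?E \<subseteq> fixed_space (?P ** ?E)"
    by (auto simp: fixed_space_def range_space_def simp flip: matrix_vector_mul_assoc)
  then have "vec.dim (fixed_space ?P \<inter> range_space ?E) \<le> vec.dim (fixed_space (?P ** ?E))"
    by (rule vec.dim_subset)
  moreover have "vec.dim (fixed_space ?P) + range_rank ?E
      \<le> vec.dim (fixed_space ?P \<inter> range_space ?E) + CARD('n)"
    using dim_add_le_dim_Int[OF subspace_fixed_space subspace_range_space subset_UNIV subset_UNIV vec.subspace_UNIV]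
    unfolding range_rank_def vec_dim_card .
  ultimately show ?case using Suc rank_nullity[of ?E] by auto
qed

text \<open>
  Since the range of \<open>Z2\<close> lies in the null space \<open>N\<close> of \<open>G\<close>, the range of \<open>G\<close> lies in the image of
  \<open>N\<close> under \<open>P Z1\<close>. The space \<open>S\<close> of all vectors in the range of \<open>Z1 Z2\<close> that \<open>P\<close> fixes lies in the
  range of \<open>G\<close>, is killed by \<open>P Z1\<close>, and has dimension at least \<open>rank G - s\<close>. Its intersection with
  \<open>N\<close> bounds from below the loss of dimension when \<open>P Z1\<close> is applied to \<open>N\<close>.
\<close>

lemma rank_le_of_factorization:
  fixes P Z1 Z2 :: "'a::field^'n^'n"
  assumes G: "G = P ** Z1 ** Z2" and Z: "Z1 ** Z1 = 0" "Z2 ** Z2 = 0"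
    and s: "CARD('n) \<le> vec.dim (fixed_space P) + s"
  shows "range_rank G + vec.dim (range_space G \<inter> null_space G) \<le> nullity G + s"
proof -
  let ?A = "P ** Z1" and ?N = "null_space G" and ?R = "range_space G"
  let ?S = "range_space (Z1 ** Z2) \<inter> fixed_space P"
  have z1: "Z1 *v (Z1 *v x) = 0" and z2: "Z2 *v (Z2 *v x) = 0" for x
    using Z by (simp_all only: matrix_vector_mul_assoc matrix_vector_mult_0)
  have Gv: "G *v x = P *v (Z1 *v (Z2 *v x))" for x by (simp add: G flip: matrix_vector_mul_assoc)
  have "?R \<subseteq> (*v) ?A ` ?N"
  proof
    fix y assume "y \<in> ?R"
    then obtain x where "y = ?A *v (Z2 *v x)" by (auto simp: range_space_def Gv simp flip: matrix_vector_mul_assoc)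
    moreover have "Z2 *v x \<in> ?N" by (simp add: Gv z2)
    ultimately show "y \<in> (*v) ?A ` ?N" by blast
  qed
  then have "range_rank G \<le> vec.dim ((*v) ?A ` ?N)" unfolding range_rank_def by (rule vec.dim_subset)
  moreover have "vec.dim ((*v) ?A ` ?N) + vec.dim (?N \<inter> null_space ?A) = nullity G"
    unfolding nullity_def by (rule dim_image_add_dim_kernel[OF subspace_null_space])
  moreover have sub: "vec.subspace ?S"
    by (intro vec.subspace_inter subspace_range_space subspace_fixed_space)
  have SR: "?S \<subseteq> ?R"
    by (auto simp: fixed_space_def range_space_def Gv simp flip: matrix_vector_mul_assoc) (metis rangeI)
  have SA: "?S \<subseteq> null_space ?A"
    by (auto simp: fixed_space_def range_space_def z1 simp flip: matrix_vector_mul_assoc)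
  have "vec.dim ?S + vec.dim (?R \<inter> ?N) \<le> vec.dim (?S \<inter> (?R \<inter> ?N)) + vec.dim ?R"
    by (rule dim_add_le_dim_Int) (use sub SR in \<open>auto intro: vec.subspace_inter subspace_range_space subspace_null_space\<close>)
  moreover have "vec.dim (?S \<inter> (?R \<inter> ?N)) \<le> vec.dim (?N \<inter> null_space ?A)"
    using SA by (intro vec.dim_subset) blast
  moreover have "range_rank (Z1 ** Z2) + vec.dim (fixed_space P) \<le> vec.dim ?S + CARD('n)"
    using dim_add_le_dim_Int[OF subspace_range_space subspace_fixed_space subset_UNIV subset_UNIV vec.subspace_UNIV]
    unfolding range_rank_def vec_dim_card .
  moreover have "range_rank G \<le> range_rank (Z1 ** Z2)"
    using range_rank_mult_le(2)[of P "Z1 ** Z2"] by (simp add: G matrix_mul_assoc)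
  ultimately show ?thesis using s unfolding range_rank_def by linarith
qed

section \<open>Splitting off idempotents\<close>

text \<open>
  The range \<open>R\<close> of \<open>G\<close> is tilted out of the null space \<open>N\<close>. The complement of \<open>R + N\<close> has the dimension
  of \<open>R \<inter> N\<close>, so up to \<open>dim (R \<inter> N)\<close> basis vectors of \<open>R \<inter> N\<close> can each be given a partner in that
  complement; \<open>T\<close> maps each of them to its partner, and \<open>H = (1 + T) G\<close>. An idempotent \<open>E\<close> that fixes
  \<open>R\<close> and kills the partners undoes the tilt.
\<close>

lemma ex_idempotent_factor:
  fixes G :: "'a::field^'n^'n"
  assumes m: "m \<le> nullity G"
  obtains E H :: "'a^'n^'n" where "G = E ** H" "E ** E = E" "nullity E = m" "null_space H = null_space G"
    "vec.dim (range_space H \<inter> null_space H) = vec.dim (range_space G \<inter> null_space G) - m"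
proof -
  let ?R = "range_space G" and ?N = "null_space G"
  let ?d = "vec.dim (?R \<inter> ?N)"
  obtain BR BN B where B: "vec.independent B" "vec.span B = UNIV" "BR \<subseteq> B" "BN \<subseteq> B"
    and sp: "vec.span BR = ?R" "vec.span BN = ?N" "vec.span (BR \<inter> BN) = ?R \<inter> ?N"
    and finB: "finite B" and cardB: "card B = CARD('n)"
    and cards: "card BR = range_rank G" "card BN = nullity G" "card (BR \<inter> BN) = ?d"
    by (rule ex_basis_adapted_matrix[of G])
  let ?C = "B - (BR \<union> BN)"
  have fin: "finite BR" "finite BN" "finite (BR \<inter> BN)" "finite ?C"
    using B finB by (auto intro: finite_subset)
  \<comment> \<open>This is where the number of available partners is seen to suffice: \<open>dim R + dim N = n\<close>.\<close>
  have cardC: "card ?C = ?d"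
    using card_Un_Int[OF fin(1,2)] cards cardB rank_nullity[of G] B fin finB
    by (subst card_Diff_subset) auto
  obtain J where J: "J \<subseteq> BR \<inter> BN" "card J = min m ?d"
    by (rule obtain_subset_with_card_n[of "min m ?d" "BR \<inter> BN"]) (use cards in auto)
  obtain J' where J': "J' \<subseteq> ?C" "card J' = min m ?d"
    by (rule obtain_subset_with_card_n[of "min m ?d" ?C]) (use cardC in auto)
  have finJ: "finite J" "finite J'" using J J' fin finite_subset by blast+
  obtain e where e: "bij_betw e J J'"
    using finite_same_card_bij[OF finJ trans[OF J(2) J'(2)[symmetric]]] by blast
  have cardBR: "card (B - BR) = nullity G"
    using B(3) cards cardB rank_nullity[of G] fin by (simp add: card_Diff_subset)
  \<comment> \<open>\<open>E\<close> has to kill the partners; further basis vectors outside the range bring its nullity up to \<open>m\<close>.\<close>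
  obtain K where K: "J' \<subseteq> K" "K \<subseteq> B - BR" "card K = m"
    using exists_subset_between[of J' m "B - BR"] J' m cardBR finB by auto
  obtain E :: "'a^'n^'n" where E: "\<And>b. b \<in> K \<Longrightarrow> E *v b = 0" "\<And>b. b \<in> B - K \<Longrightarrow> E *v b = b"
    "E ** E = E" "nullity E = card K"
    by (rule ex_idempotent_on_basis[OF B(1,2), of K]) (use K in auto)
  obtain T :: "'a^'n^'n" where T: "\<forall>b\<in>B. T *v b = (if b \<in> J then e b else 0)"
    using ex_matrix_on_basis[OF B(1), where f = "\<lambda>b. if b \<in> J then e b else 0"] by blast
  have eJ: "e b \<in> J'" if "b \<in> J" for b using e that by (auto simp: bij_betw_def)
  have Tb: "T *v b \<in> insert 0 J'" if "b \<in> B" for b using T eJ that by auto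
  have Tspan: "T *v b \<in> vec.span J'" if "b \<in> B" for b
    using Tb[OF that] vec.span_zero vec.span_base by (metis insertE)
  define H where "H = (mat 1 + T) ** G"
  have Hv: "H *v x = G *v x + T *v (G *v x)" for x
    by (simp add: H_def matrix_vector_mult_add_rdistrib flip: matrix_vector_mul_assoc)
  have ER: "E *v y = y" and ETR: "(E ** T) *v y = 0 *v y" if "y \<in> ?R" for y
  proof -
    have y: "y \<in> vec.span BR" using that sp by simp
    have "E *v y = mat 1 *v y"
      by (rule matrix_eq_on_span[OF _ y]) (use E(2) K(2) B(3) in \<open>simp add: subset_iff, blast\<close>)
    then show "E *v y = y" by simp
    have "E *v (T *v b) = 0" if "b \<in> BR" for b
      using Tb[of b] B(3) K(1) E(1) that by (metis insertE matrix_vector_mult_0_right subsetD)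
    then show "(E ** T) *v y = 0 *v y"
      by (intro matrix_eq_on_span[OF _ y]) (simp flip: matrix_vector_mul_assoc)
  qed
  have EHv: "E *v (H *v x) = G *v x" for x
    using ER[of "G *v x"] ETR[of "G *v x"]
    by (simp add: Hv matrix_vector_right_distrib flip: matrix_vector_mul_assoc)
  have G: "G = E ** H" by (simp add: matrix_eq EHv flip: matrix_vector_mul_assoc)
  have null: "null_space H = ?N"
  proof
    show "null_space H \<subseteq> ?N" using EHv by (auto simp: null_space_def) (metis matrix_vector_mult_0_right)
    show "?N \<subseteq> null_space H" by (auto simp: Hv)
  qed
  \<comment> \<open>If \<open>y + T y\<close> lies in \<open>N\<close> with \<open>y\<close> in \<open>R\<close>, then \<open>T y\<close> lies in \<open>R + N\<close> and in the span of the
      partners, so \<open>T y = 0\<close>: only untilted vectors stay in \<open>N\<close>.\<close>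
  have RH: "range_space H \<inter> ?N = (?R \<inter> ?N) \<inter> null_space T"
  proof
    show "range_space H \<inter> ?N \<subseteq> (?R \<inter> ?N) \<inter> null_space T"
    proof
      fix x assume x: "x \<in> range_space H \<inter> ?N"
      then obtain y where y: "y \<in> ?R" "x = y + T *v y" by (auto simp: range_space_def Hv)
      have "(*v) T ` BR \<subseteq> vec.span J'"
      proof (rule image_subsetI)
        fix b assume "b \<in> BR"
        then show "T *v b \<in> vec.span J'"
          using Tspan B(3) by blast
      qed
      then have "vec.span ((*v) T ` BR) \<subseteq> vec.span J'"
        by (rule vec.span_minimal[OF _ vec.subspace_span])
      then have "T *v y \<in> vec.span J'"
        using y(1) unfolding sp(1)[symmetric] vec.span_image by blast
      moreover have "T *v y \<in> vec.span (BR \<union> BN)"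
      proof -
        have "x \<in> vec.span (BR \<union> BN)" "y \<in> vec.span (BR \<union> BN)"
          using x y(1) sp vec.span_mono[of BR "BR \<union> BN"] vec.span_mono[of BN "BR \<union> BN"] by auto
        then have "x - y \<in> vec.span (BR \<union> BN)" by (rule vec.span_diff)
        then show ?thesis using y(2) by simp
      qed
      ultimately have "T *v y = 0"
        by (intro eq_0_if_in_disjoint_spans[OF B(1), of J' "BR \<union> BN"]) (use J' B in auto)
      then show "x \<in> (?R \<inter> ?N) \<inter> null_space T" using x y by simp
    qed
    show "(?R \<inter> ?N) \<inter> null_space T \<subseteq> range_space H \<inter> ?N"
    proof
      fix x assume "x \<in> (?R \<inter> ?N) \<inter> null_space T"
      moreover from this obtain u where "x = G *v u" by (auto simp: range_space_def)
      ultimately show "x \<in> range_space H \<inter> ?N" using in_range_space[of H u] by (auto simp: Hv)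
    qed
  qed
  have "vec.dim ((*v) T ` (?R \<inter> ?N)) = card J'"
  proof (rule vec.dim_unique)
    have img: "T *v b \<in> vec.span J'" if "b \<in> BR \<inter> BN" for b
      using Tspan B(3) that by blast
    then have "vec.span ((*v) T ` (BR \<inter> BN)) \<subseteq> vec.span J'"
      by (intro vec.span_minimal[OF _ vec.subspace_span]) auto
    then show "(*v) T ` (?R \<inter> ?N) \<subseteq> vec.span J'" unfolding vec.span_image sp .
    show "J' \<subseteq> (*v) T ` (?R \<inter> ?N)"
    proof
      fix c assume "c \<in> J'"
      then obtain b where b: "b \<in> J" "c = e b" using e by (auto simp: bij_betw_def)
      have "b \<in> ?R \<inter> ?N" using b(1) J(1) vec.span_base[of b "BR \<inter> BN"] sp(3) by blast
      moreover have "c = T *v b" using T b J B by auto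
      ultimately show "c \<in> (*v) T ` (?R \<inter> ?N)" by blast
    qed
    show "vec.independent J'" using J' by (intro vec.independent_mono[OF B(1)]) auto
  qed simp
  then have "vec.dim (range_space H \<inter> ?N) = ?d - m"
    using dim_image_add_dim_kernel[OF vec.subspace_inter[OF subspace_range_space subspace_null_space], of T G G] J'(2)
    unfolding RH by linarith
  then show ?thesis using that[OF G E(3) _ null] E(4) K(3) unfolding null by simp
qed

lemma matrix_prod_cong:
  "(\<And>i. i \<in> {1..k} \<Longrightarrow> E i = E' i) \<Longrightarrow> matrix_prod E k = matrix_prod E' k"
  by (induction k) auto

text \<open>
  Every step keeps the null space, hence the bound \<open>ns i \<le> nullity G\<close> that the next step requires. The
  subtraction truncates: once range and null space meet trivially, further idempotents can
  still be split off.
\<close>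

lemma ex_idempotent_factors:
  fixes G :: "'a::field^'n^'n"
  assumes "\<forall>i\<in>{1..k}. ns i \<le> nullity G"
  shows "\<exists>(E :: nat \<Rightarrow> 'a^'n^'n) H. G = matrix_prod E k ** H \<and>
    (\<forall>i\<in>{1..k}. E i ** E i = E i \<and> nullity (E i) = ns i) \<and> null_space H = null_space G \<and>
    vec.dim (range_space H \<inter> null_space H)
      = vec.dim (range_space G \<inter> null_space G) - (\<Sum>i=1..k. ns i)"
  using assms
proof (induction k)
  case 0
  show ?case by (intro exI[of _ "\<lambda>_. 0"] exI[of _ G]) simp
next
  case (Suc k)
  then obtain E :: "nat \<Rightarrow> 'a^'n^'n" and H where E: "G = matrix_prod E k ** H"
      "\<forall>i\<in>{1..k}. E i ** E i = E i \<and> nullity (E i) = ns i" and H: "null_space H = null_space G"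
      "vec.dim (range_space H \<inter> null_space H)
        = vec.dim (range_space G \<inter> null_space G) - (\<Sum>i=1..k. ns i)"
    by auto
  have "ns (Suc k) \<le> nullity H" using Suc.prems H(1) by (simp add: nullity_def)
  then obtain F H' :: "'a^'n^'n" where F: "H = F ** H'" "F ** F = F" "nullity F = ns (Suc k)"
    and H': "null_space H' = null_space H"
      "vec.dim (range_space H' \<inter> null_space H')
        = vec.dim (range_space H \<inter> null_space H) - ns (Suc k)"
    by (rule ex_idempotent_factor)
  define E' where "E' = E(Suc k := F)"
  have "matrix_prod E' k = matrix_prod E k" unfolding E'_def by (rule matrix_prod_cong) auto
  then have "G = matrix_prod E' (Suc k) ** H'"
    using E(1) F(1) by (simp add: E'_def matrix_mul_assoc)
  moreover have "\<forall>i\<in>{1..Suc k}. E' i ** E' i = E' i \<and> nullity (E' i) = ns i"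
    using E(2) F(2,3) by (auto simp: E'_def)
  moreover have "vec.dim (range_space H' \<inter> null_space H')
      = vec.dim (range_space G \<inter> null_space G) - (\<Sum>i=1..Suc k. ns i)"
    using H(2) H'(2) by simp
  ultimately show ?case using H(1) H'(1) by blast
qed

section \<open>Products of two square-zero matrices\<close>

text \<open>
  Let \<open>R\<close> and \<open>N\<close> be the range and the null space of \<open>G\<close>. The first hypothesis provides a subspace \<open>W\<close>
  of \<open>N\<close> that is isomorphic to \<open>R\<close> and meets \<open>R\<close> trivially. Then \<open>G\<close> factors as a map \<open>Z2\<close> from a complement
  of \<open>N\<close> to \<open>W\<close>, followed by a map \<open>Z1\<close> from \<open>W\<close> to \<open>R\<close>. To reach the prescribed nullities, \<open>Z2\<close> also moves a
  set \<open>A2\<close> of spare basis vectors of \<open>N\<close> injectively to \<open>Q2\<close>, and \<open>Z1\<close> moves a set \<open>A1\<close> of spare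
  vectors to \<open>Q1\<close>. The product is not affected as long as \<open>Z1\<close> kills \<open>Q2\<close>, which holds when \<open>A1\<close>
  avoids \<open>Q2\<close>.
\<close>

lemma ex_square_zero_factorization:
  fixes G :: "'a::field^'n^'n"
  assumes d: "range_rank G + vec.dim (range_space G \<inter> null_space G) \<le> nullity G"
    and z1: "z1 \<le> nullity G" "CARD('n) \<le> 2 * z1"
    and z2: "z2 \<le> nullity G" "CARD('n) \<le> 2 * z2"
  obtains Z1 Z2 :: "'a^'n^'n" where "G = Z1 ** Z2" "Z1 ** Z1 = 0" "Z2 ** Z2 = 0"
    "nullity Z1 = z1" "nullity Z2 = z2"
proof -
  let ?R = "range_space G" and ?N = "null_space G"
  let ?d = "vec.dim (?R \<inter> ?N)"
  let ?r = "range_rank G"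
  have rn: "?r + nullity G = CARD('n)" by (rule rank_nullity)
  obtain BR BN B where B: "vec.independent B" "vec.span B = UNIV" "BR \<subseteq> B" "BN \<subseteq> B"
    and sp: "vec.span BR = ?R" "vec.span BN = ?N" "vec.span (BR \<inter> BN) = ?R \<inter> ?N"
    and finB: "finite B" and cardB: "card B = CARD('n)"
    and cards: "card BR = range_rank G" "card BN = nullity G" "card (BR \<inter> BN) = ?d"
    by (rule ex_basis_adapted_matrix[of G])
  have fin: "finite BR" "finite BN" using B finB by (auto intro: finite_subset)
  have G0: "G *v b = 0" if "b \<in> BN" for b using vec.span_base[OF that] sp(2) by simp
  have cW: "card (BN - BR) = nullity G - ?d"
    using cards fin by (simp add: card_Diff_subset_Int Int_commute)
  obtain W where W: "W \<subseteq> BN - BR" "card W = ?r" "finite W"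
    by (rule obtain_subset_with_card_n[of ?r "BN - BR"]) (use cW d in auto)
  obtain \<phi> where \<phi>: "bij_betw \<phi> BR W"
    using finite_same_card_bij[OF fin(1) W(3) trans[OF cards(1) W(2)[symmetric]]] by blast
  let ?\<psi> = "the_inv_into BR \<phi>"
  have \<psi>: "bij_betw ?\<psi> W BR" using \<phi> by (rule bij_betw_the_inv_into)
  have \<psi>\<phi>: "?\<psi> (\<phi> b) = b" if "b \<in> BR" for b
    using \<phi> that by (simp add: bij_betw_def the_inv_into_f_f)
  \<comment> \<open>\<open>Z2\<close> is prescribed on a basis different from that of \<open>Z1\<close>: preimages under \<open>G\<close> of the basis of \<open>R\<close>
      span a complement of \<open>N\<close>.\<close>
  have "\<forall>b\<in>BR. \<exists>x. G *v x = b"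
    using vec.span_base[of _ BR] sp(1) by (auto simp: range_space_def)
  then obtain g where g: "\<And>b. b \<in> BR \<Longrightarrow> G *v g b = b" by metis
  let ?X = "g ` BR"
  have gX: "G *v x \<in> BR" "g (G *v x) = x" if "x \<in> ?X" for x using that g by auto
  have injg: "inj_on g BR" using g by (metis inj_onI)
  have cardX: "card ?X = ?r" using cards(1) card_image[OF injg] by simp
  have finX: "finite ?X" using fin by simp
  have spanX: "vec.span (?X \<union> BN) = UNIV"
  proof (intro antisym subset_UNIV subsetI)
    fix v
    have "(*v) G ` ?X = BR" using g by force
    then have "(*v) G ` vec.span ?X = ?R" using sp(1) by (metis vec.span_image)
    then obtain u where u: "u \<in> vec.span ?X" "G *v v = G *v u"
      using in_range_space[of G v] by (metis imageE)
    have "v - u \<in> vec.span BN" using u(2) sp(2) by (simp add: matrix_vector_mult_diff_distrib)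
    then have "u + (v - u) \<in> vec.span (?X \<union> BN)"
      using u(1) by (intro vec.span_add) (meson Un_upper1 Un_upper2 subsetD vec.span_mono)+
    then show "v \<in> vec.span (?X \<union> BN)" by simp
  qed
  have indX: "vec.independent (?X \<union> BN)"
  proof (rule vec.card_le_dim_spanning[of _ UNIV])
    show "card (?X \<union> BN) \<le> vec.dim (UNIV :: ('a^'n) set)"
      unfolding vec_dim_card using card_Un_le[of ?X BN] cardX cards rn by linarith
  qed (use spanX finX fin in auto)
  have "0 \<notin> BR"
    using vec.independent_mono[OF B(1,3)] vec.dependent_zero by blast
  then have disj: "?X \<inter> BN = {}" using gX(1) G0 by force
  \<comment> \<open>Outside \<open>W\<close> there are \<open>nullity G - rank G = n - 2 rank G\<close> spare vectors in the basis of \<open>N\<close>, and the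
      rank of \<open>Z2\<close> has to rise by \<open>n - z2 - rank G = nullity G - z2\<close>. As \<open>n \<le> 2 z2\<close>, disjoint sets
      \<open>A2\<close> and \<open>Q2\<close> of this size fit.\<close>
  have cS: "card (BN - W) = nullity G - ?r"
    using W fin cards by (subst card_Diff_subset) auto
  obtain A2 where A2: "A2 \<subseteq> BN - W" "card A2 = nullity G - z2" "finite A2"
    by (rule obtain_subset_with_card_n[of "nullity G - z2" "BN - W"]) (use cS rn z2 in auto)
  have cQ2: "card (BN - W - A2) = nullity G - ?r - (nullity G - z2)"
    using A2 cS by (subst card_Diff_subset) auto
  obtain Q2 where Q2: "Q2 \<subseteq> BN - W - A2" "card Q2 = nullity G - z2" "finite Q2"
    by (rule obtain_subset_with_card_n[of "nullity G - z2" "BN - W - A2"]) (use cQ2 rn z2 in auto)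
  obtain h2 where h2: "bij_betw h2 A2 Q2"
    using finite_same_card_bij[OF A2(3) Q2(3) trans[OF A2(2) Q2(2)[symmetric]]] by blast
  let ?f2 = "\<lambda>b. if b \<in> ?X then \<phi> (G *v b) else h2 b"
  have "bij_betw (\<lambda>b. \<phi> (G *v b)) ?X W"
  proof -
    have "bij_betw ((*v) G) ?X BR" using gX g by (intro bij_betwI[of _ _ _ g]) auto
    then show ?thesis using bij_betw_trans[OF _ \<phi>] by (simp add: comp_def)
  qed
  then have f2: "bij_betw ?f2 (?X \<union> A2) (W \<union> Q2)"
    using h2 disj A2 Q2 by (intro bij_betw_disjoint_Un) auto
  obtain Z2 :: "'a^'n^'n" where Z2: "\<And>b. b \<in> ?X \<union> A2 \<Longrightarrow> Z2 *v b = ?f2 b"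
      "\<And>b. b \<in> ?X \<union> BN - (?X \<union> A2) \<Longrightarrow> Z2 *v b = 0" "Z2 ** Z2 = 0"
      "nullity Z2 = CARD('n) - card (?X \<union> A2)"
  proof (rule ex_square_zero_on_basis[OF indX spanX, of "?X \<union> A2" ?f2])
    show "?f2 ` (?X \<union> A2) \<subseteq> ?X \<union> BN - (?X \<union> A2)"
      unfolding bij_betw_imp_surj_on[OF f2] using W(1) A2(1) Q2(1) disj by blast
  qed (use A2(1) bij_betw_imp_inj_on[OF f2] in blast)+
  have nZ2: "nullity Z2 = z2"
  proof -
    have "card (?X \<union> A2) = ?r + (nullity G - z2)"
      using A2 disj finX cardX by (subst card_Un_disjoint) auto
    then show ?thesis using Z2(4) z2 rn by simp
  qed
  \<comment> \<open>The spare vectors for \<open>Z1\<close> are those outside \<open>R\<close> and \<open>W\<close>. Avoiding \<open>Q2\<close> leaves room for \<open>A1\<close> because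
      \<open>(nullity G - z1) + (nullity G - z2) \<le> nullity G - rank G\<close>, and \<open>Q1\<close> may overlap \<open>Q2\<close>.\<close>
  let ?T = "B - BR - W"
  have cT: "card ?T = nullity G - ?r"
  proof -
    have "?T = B - (BR \<union> W)" by auto
    moreover have "card (BR \<union> W) = ?r + ?r" using W fin cards by (subst card_Un_disjoint) auto
    ultimately show ?thesis using W B fin cardB rn by (simp add: card_Diff_subset subset_iff)
  qed
  have cA1: "card (?T - Q2) \<ge> nullity G - ?r - (nullity G - z2)"
    using diff_card_le_card_Diff[OF Q2(3), of ?T] cT Q2(2) by simp
  obtain A1 where A1: "A1 \<subseteq> ?T - Q2" "card A1 = nullity G - z1" "finite A1"
    by (rule obtain_subset_with_card_n[of "nullity G - z1" "?T - Q2"]) (use cA1 rn z1 z2 in auto)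
  have cQ1: "card (?T - A1) = nullity G - ?r - (nullity G - z1)"
    using A1 cT by (subst card_Diff_subset) auto
  obtain Q1 where Q1: "Q1 \<subseteq> ?T - A1" "card Q1 = nullity G - z1" "finite Q1"
    by (rule obtain_subset_with_card_n[of "nullity G - z1" "?T - A1"]) (use cQ1 rn z1 in auto)
  obtain h1 where h1: "bij_betw h1 A1 Q1"
    using finite_same_card_bij[OF A1(3) Q1(3) trans[OF A1(2) Q1(2)[symmetric]]] by blast
  let ?f1 = "\<lambda>b. if b \<in> W then ?\<psi> b else h1 b"
  have f1: "bij_betw ?f1 (W \<union> A1) (BR \<union> Q1)"
    using h1 \<psi> A1 Q1 by (intro bij_betw_disjoint_Un) auto
  obtain Z1 :: "'a^'n^'n" where Z1: "\<And>b. b \<in> W \<union> A1 \<Longrightarrow> Z1 *v b = ?f1 b"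
      "\<And>b. b \<in> B - (W \<union> A1) \<Longrightarrow> Z1 *v b = 0" "Z1 ** Z1 = 0"
      "nullity Z1 = CARD('n) - card (W \<union> A1)"
  proof (rule ex_square_zero_on_basis[OF B(1,2), of "W \<union> A1" ?f1])
    show "?f1 ` (W \<union> A1) \<subseteq> B - (W \<union> A1)"
      unfolding bij_betw_imp_surj_on[OF f1] using W(1) B(3,4) A1(1) Q1(1) by blast
  qed (use A1(1) W(1) B(4) bij_betw_imp_inj_on[OF f1] in blast)+
  have nZ1: "nullity Z1 = z1"
  proof -
    have "card (W \<union> A1) = ?r + (nullity G - z1)"
      using A1 W by (subst card_Un_disjoint) auto
    then show ?thesis using Z1(4) z1 rn by simp
  qed
  have "G = Z1 ** Z2"
  proof (rule matrix_eqI_basis[OF spanX])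
    fix b assume b: "b \<in> ?X \<union> BN"
    consider "b \<in> ?X" | "b \<in> A2" | "b \<in> BN - A2" using b by blast
    then show "G *v b = (Z1 ** Z2) *v b"
    proof cases
      case 1
      then have "Z2 *v b = \<phi> (G *v b)" using Z2(1) by simp
      moreover have "\<phi> (G *v b) \<in> W" using \<phi> gX(1)[OF 1] by (auto simp: bij_betw_def)
      ultimately show ?thesis using Z1(1) \<psi>\<phi>[OF gX(1)[OF 1]] by (simp flip: matrix_vector_mul_assoc)
    next
      case 2
      then have "b \<notin> ?X" using A2 disj by blast
      then have "Z2 *v b = h2 b" using Z2(1)[of b] 2 by simp
      moreover have "h2 b \<in> Q2" using h2 2 by (auto simp: bij_betw_def)
      then have "Z1 *v h2 b = 0" using Q2(1) A1(1) W(1) B(4) by (intro Z1(2)) blast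
      ultimately show ?thesis using G0 2 A2 by (simp add: subset_iff flip: matrix_vector_mul_assoc)
    next
      case 3
      then have "Z2 *v b = 0" using disj by (intro Z2(2)) blast
      then show ?thesis using G0 3 by (simp flip: matrix_vector_mul_assoc)
    qed
  qed
  then show ?thesis using Z1(3) Z2(3) nZ1 nZ2 by (rule that)
qed

section \<open>The characterization\<close>

theorem theorem1:
  fixes G :: "'a::field^'n^'n"
    and k :: nat
    and ns :: "nat \<Rightarrow> nat"
    and nZ1 nZ2 :: nat
  assumes "k \<ge> 1"
  shows "(\<exists>(E :: nat \<Rightarrow> 'a^'n^'n) (Z1 :: 'a^'n^'n) (Z2 :: 'a^'n^'n).
            G = matrix_prod E k ** Z1 ** Z2 \<and>
            (\<forall>i\<in>{1..k}. E i ** E i = E i \<and> nullity (E i) = ns i) \<and>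
            Z1 ** Z1 = 0 \<and> Z2 ** Z2 = 0 \<and>
            nullity Z1 = nZ1 \<and> nullity Z2 = nZ2)
     \<longleftrightarrow>
         (range_rank G \<le> (\<Sum>i=1..k. ns i) + nullity0 G \<and>
          (\<forall>i\<in>{1..k}. ns i \<le> nullity G) \<and> nZ1 \<le> nullity G \<and> nZ2 \<le> nullity G \<and>
          real nZ1 \<ge> real CARD('n) / 2 \<and> real nZ2 \<ge> real CARD('n) / 2)"
  (is "?factors \<longleftrightarrow> ?bounds")
proof
  assume ?factors
  then obtain E :: "nat \<Rightarrow> 'a^'n^'n" and Z1 Z2 where G: "G = matrix_prod E k ** Z1 ** Z2"
    and E: "\<forall>i\<in>{1..k}. E i ** E i = E i" "\<forall>i\<in>{1..k}. nullity (E i) = ns i"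
    and Z: "Z1 ** Z1 = 0" "Z2 ** Z2 = 0" "nullity Z1 = nZ1" "nullity Z2 = nZ2"
    by blast
  let ?P = "matrix_prod E k"
  have "(\<Sum>i=1..k. nullity (E i)) = (\<Sum>i=1..k. ns i)" using E(2) by (intro sum.cong) auto
  then have "CARD('n) \<le> vec.dim (fixed_space ?P) + (\<Sum>i=1..k. ns i)"
    using dim_fixed_space_matrix_prod[OF E(1)] by simp
  from rank_le_of_factorization[OF G Z(1,2) this]
  have rank: "range_rank G \<le> (\<Sum>i=1..k. ns i) + nullity0 G" using nullity0_add[of G] by linarith
  have G': "G = ?P ** (Z1 ** Z2)" by (simp add: G matrix_mul_assoc)
  have "ns i \<le> nullity G" if "i \<in> {1..k}" for i
    using nullity_matrix_prod_ge[OF that, of E] nullity_le_mult(1)[of ?P "Z1 ** Z2"] E(2) that G' by auto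
  moreover have "nZ1 \<le> nullity G"
    using nullity_le_mult(2)[where A = ?P and B = Z1] nullity_le_mult(1)[of "?P ** Z1" Z2] G Z(3) by simp
  moreover have "nZ2 \<le> nullity G"
    using nullity_le_mult(2)[where A = "?P ** Z1" and B = Z2] G Z(4) by simp
  moreover have "CARD('n) \<le> 2 * nZ1" "CARD('n) \<le> 2 * nZ2"
    using nullity_square_zero_ge Z by blast+
  then have "real nZ1 \<ge> real CARD('n) / 2" "real nZ2 \<ge> real CARD('n) / 2" by linarith+
  ultimately show ?bounds using rank by blast
next
  assume bounds: ?bounds
  then obtain E :: "nat \<Rightarrow> 'a^'n^'n" and H where G: "G = matrix_prod E k ** H"
    and E: "\<forall>i\<in>{1..k}. E i ** E i = E i \<and> nullity (E i) = ns i"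
    and H: "null_space H = null_space G"
      "vec.dim (range_space H \<inter> null_space H)
        = vec.dim (range_space G \<inter> null_space G) - (\<Sum>i=1..k. ns i)"
    using ex_idempotent_factors[of k ns G] by blast
  have nH: "nullity H = nullity G" using H(1) by (simp add: nullity_def)
  have half: "CARD('n) \<le> 2 * nZ1" "CARD('n) \<le> 2 * nZ2" using bounds by linarith+
  have le: "nZ1 \<le> nullity H" "nZ2 \<le> nullity H" using bounds nH by auto
  \<comment> \<open>If the sum of the \<open>ns i\<close> exceeds \<open>dim (R \<inter> N)\<close>, the intersection is trivial and the claim comes
      from \<open>n \<le> 2 nZ1 \<le> 2 nullity H\<close>; otherwise it is the rank condition.\<close>
  have "range_rank H + vec.dim (range_space H \<inter> null_space H) \<le> nullity H"
    using bounds nullity0_add[of G] H(2) nH rank_nullity[of G] rank_nullity[of H] half le by linarith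
  from ex_square_zero_factorization[OF this le(1) half(1) le(2) half(2)]
  obtain Z1 Z2 :: "'a^'n^'n" where "H = Z1 ** Z2" "Z1 ** Z1 = 0" "Z2 ** Z2 = 0"
    "nullity Z1 = nZ1" "nullity Z2 = nZ2" .
  then show ?factors using G E by (intro exI[of _ E] exI[of _ Z1] exI[of _ Z2]) (simp add: matrix_mul_assoc)
qed

end
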